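(* Let $v\ge k\ge 3$ and $c\ge 2$ be integers. Write $k=qc+b$ and $v=\rho c+\beta$ with integers $q,\rho$ and $0\le b<c$, $0\le\beta<c$. If there exists a block-equitably $c$-coloured packing {\rm PD}$(v,k,1)$ with $m$ blocks, then \[ m\le \frac{\rho\left(\frac{\rho c}{2}+\beta\right)(c-1)+\frac{\beta}{2}(\beta-1)}{q\left(\frac{qc}{2}+b\right)(c-1)+\frac{b}{2}(b-1)}. \]
   Context: A packing design {\rm PD}$(v,k,1)$ is a pair $(V,{\cal B})$ where $|V|=v$ and ${\cal B}$ is a collection of $k$-subsets (blocks) of $V$ such that every pair of points occurs in at most one block; its size is the number of blocks. A $c$-colouring is a function $f:V\to{\cal C}$ with $|{\cal C}|=c$, with colour classes $F(\gamma)=f^{-1}(\gamma)$; it is block-equitable if $\lfloor k/c\rfloor\le |B\cap F(\gamma)|\le\lceil k/c\rceil$ for every colour $\gamma$ and every block $B$. *)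

theory Defs
  imports Complex_Main "HOL-Library.Multiset" "HOL-Library.FuncSet"
begin

text \<open>Blocks form a multiset, so repeated blocks are not excluded by the encoding;
  an unordered pair is counted once for each occurrence of a block containing it.\<close>

definition packing_design :: "nat \<Rightarrow> nat \<Rightarrow> 'a set \<Rightarrow> 'a set multiset \<Rightarrow> bool" where
  "packing_design v k V \<B> \<longleftrightarrow>
     finite V \<and> card V = v \<and>
     (\<forall>B \<in># \<B>. B \<subseteq> V \<and> card B = k) \<and>
     (\<forall>x \<in> V. \<forall>y \<in> V. x \<noteq> y \<longrightarrow> size {#B \<in># \<B>. x \<in> B \<and> y \<in> B#} \<le> 1)"

text \<open>A colouring need not use every colour of \<open>C\<close>.\<close>

definition colouring :: "nat \<Rightarrow> 'a set \<Rightarrow> 'b set \<Rightarrow> ('a \<Rightarrow> 'b) \<Rightarrow> bool" where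
  "colouring c V C f \<longleftrightarrow> finite C \<and> card C = c \<and> f \<in> V \<rightarrow> C"

definition colour_class :: "'a set \<Rightarrow> ('a \<Rightarrow> 'b) \<Rightarrow> 'b \<Rightarrow> 'a set" where
  "colour_class V f \<gamma> = {x \<in> V. f x = \<gamma>}"

definition block_equitable ::
  "nat \<Rightarrow> nat \<Rightarrow> 'a set \<Rightarrow> 'a set multiset \<Rightarrow> 'b set \<Rightarrow> ('a \<Rightarrow> 'b) \<Rightarrow> bool" where
  "block_equitable k c V \<B> C f \<longleftrightarrow>
     (\<forall>\<gamma> \<in> C. \<forall>B \<in># \<B>.
        \<lfloor>real k / real c\<rfloor> \<le> int (card (B \<inter> colour_class V f \<gamma>)) \<and>
        int (card (B \<inter> colour_class V f \<gamma>)) \<le> \<lceil>real k / real c\<rceil>)"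

end

theory Submission
  imports Defs
begin

text \<open>
  Count ordered pairs of points with distinct colours. A set of size \<open>s = r * c + t\<close> whose
  colour classes have sizes \<open>n \<gamma>\<close> contains \<open>s\<^sup>2 - (\<Sum>\<gamma>. (n \<gamma>)\<^sup>2)\<close> of them, which equals
  \<open>c (c - 1) r\<^sup>2 + 2 r t (c - 1) + t (t - 1)\<close> minus the sum of the terms \<open>(n \<gamma> - r) (n \<gamma> - r - 1)\<close>.
  These terms are nonnegative for integers, and vanish when every class has size \<open>r\<close> or \<open>r + 1\<close>.
  So each block contains exactly the number of bichromatic pairs in (twice) the denominator,
  the whole point set at most that in (twice) the numerator, and no pair is in two blocks.
\<close>

definition bichromatic_pairs :: "'a set \<Rightarrow> ('a \<Rightarrow> 'b) \<Rightarrow> ('a \<times> 'a) set" where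
  "bichromatic_pairs S f = {(x, y). x \<in> S \<and> y \<in> S \<and> f x \<noteq> f y}"

lemma finite_bichromatic_pairs: "finite S \<Longrightarrow> finite (bichromatic_pairs S f)"
  by (rule finite_subset[of _ "S \<times> S"]) (auto simp: bichromatic_pairs_def)

text \<open>Removing monochromatic pairs from \<open>S \<times> S\<close> leaves a sum of squares.
  Each square is \<open>(n - r) * (n - r - 1)\<close> plus an affine function of the class size
  \<open>n\<close>, and the affine parts sum to a value fixed by \<open>card S\<close> and
  \<open>c\<close>. Being an identity, it yields the exact count for blocks and the bound for
  \<open>V\<close>.\<close>

lemma card_bichromatic_pairs:
  assumes "finite S" "colouring c S C f" and s: "int (card S) = r * int c + t"
  shows "int (card (bichromatic_pairs S f)) =
    int c * (int c - 1) * r\<^sup>2 + 2 * r * t * (int c - 1) + t * (t - 1)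
    - (\<Sum>\<gamma>\<in>C. (int (card (colour_class S f \<gamma>)) - r) * (int (card (colour_class S f \<gamma>)) - r - 1))"
proof -
  let ?n = "\<lambda>\<gamma>. int (card (colour_class S f \<gamma>))"
  have C: "finite C" "card C = c" "f \<in> S \<rightarrow> C"
    using assms(2) by (auto simp: colouring_def)
  have fin: "finite (colour_class S f \<gamma>)" for \<gamma>
    using assms(1) by (simp add: colour_class_def)
  have "S = (\<Union>\<gamma>\<in>C. colour_class S f \<gamma>)"
    using C(3) by (auto simp: colour_class_def)
  then have "card S = (\<Sum>\<gamma>\<in>C. card (colour_class S f \<gamma>))"
    using card_UN_disjoint[OF C(1), of "colour_class S f"] fin
    by (auto simp: colour_class_def)
  then have sum1: "(\<Sum>\<gamma>\<in>C. ?n \<gamma>) = r * int c + t"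
    using s by simp
  have "card (\<Union>\<gamma>\<in>C. colour_class S f \<gamma> \<times> colour_class S f \<gamma>) =
      (\<Sum>\<gamma>\<in>C. card (colour_class S f \<gamma> \<times> colour_class S f \<gamma>))"
    by (rule card_UN_disjoint) (use C(1) fin in \<open>auto simp: colour_class_def\<close>)
  then have mono: "int (card (\<Union>\<gamma>\<in>C. colour_class S f \<gamma> \<times> colour_class S f \<gamma>)) = (\<Sum>\<gamma>\<in>C. (?n \<gamma>)\<^sup>2)"
    by (simp add: card_cartesian_product power2_eq_square)
  have "S \<times> S = bichromatic_pairs S f \<union> (\<Union>\<gamma>\<in>C. colour_class S f \<gamma> \<times> colour_class S f \<gamma>)"
    using C(3) by (auto simp: bichromatic_pairs_def colour_class_def)
  moreover have "card (bichromatic_pairs S f \<union> (\<Union>\<gamma>\<in>C. colour_class S f \<gamma> \<times> colour_class S f \<gamma>)) =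
     card (bichromatic_pairs S f) + card (\<Union>\<gamma>\<in>C. colour_class S f \<gamma> \<times> colour_class S f \<gamma>)"
    by (rule card_Un_disjoint)
      (use C(1) fin finite_bichromatic_pairs[OF assms(1)]
        in \<open>auto simp: bichromatic_pairs_def colour_class_def\<close>)
  ultimately have "card S * card S =
     card (bichromatic_pairs S f) + card (\<Union>\<gamma>\<in>C. colour_class S f \<gamma> \<times> colour_class S f \<gamma>)"
    by (metis card_cartesian_product)
  then have "int (card S) * int (card S) = int (card (bichromatic_pairs S f)) + (\<Sum>\<gamma>\<in>C. (?n \<gamma>)\<^sup>2)"
    unfolding mono[symmetric] by (metis of_nat_add of_nat_mult)
  then have pairs: "int (card (bichromatic_pairs S f)) = (r * int c + t)\<^sup>2 - (\<Sum>\<gamma>\<in>C. (?n \<gamma>)\<^sup>2)"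
    unfolding s power2_eq_square by simp
  have "(\<Sum>\<gamma>\<in>C. (?n \<gamma> - r) * (?n \<gamma> - r - 1)) =
      (\<Sum>\<gamma>\<in>C. (?n \<gamma>)\<^sup>2 - (2 * r + 1) * ?n \<gamma> + r * (r + 1))"
    by (intro sum.cong refl) (simp add: power2_eq_square algebra_simps)
  also have "\<dots> = (\<Sum>\<gamma>\<in>C. (?n \<gamma>)\<^sup>2) - (2 * r + 1) * (r * int c + t) + int c * (r * (r + 1))"
    by (simp add: sum.distrib sum_subtractf C(2) flip: sum_distrib_left sum1)
  finally show ?thesis
    unfolding pairs by (simp add: power2_eq_square algebra_simps)
qed

text \<open>Double counting of incidences, with repeated blocks counted by multiplicity.\<close>

lemma sum_mset_card_eq_sum_size_filter:
  assumes "finite P"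
  shows "(\<Sum>B\<in>#\<B>. card {p \<in> P. R p B}) = (\<Sum>p\<in>P. size {#B \<in># \<B>. R p B#})"
proof (induction \<B>)
  case (add B \<B>)
  have "(\<Sum>p\<in>P. size {#D \<in># add_mset B \<B>. R p D#}) =
      (\<Sum>p\<in>P. of_bool (R p B) + size {#D \<in># \<B>. R p D#})"
    by (intro sum.cong) auto
  also have "\<dots> = card {p \<in> P. R p B} + (\<Sum>p\<in>P. size {#D \<in># \<B>. R p D#})"
    using assms by (simp add: sum.distrib Int_def)
  finally show ?case
    using add by simp
qed simp

text \<open>Points of different colours are distinct, so the packing condition applies to every pair
  counted here.\<close>

lemma sum_bichromatic_pairs_blocks_le:
  assumes "packing_design v k V \<B>"
  shows "(\<Sum>B\<in>#\<B>. card (bichromatic_pairs B f)) \<le> card (bichromatic_pairs V f)"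
proof -
  let ?P = "bichromatic_pairs V f"
  let ?R = "\<lambda>p B. fst p \<in> B \<and> snd p \<in> B"
  have "finite ?P"
    using assms by (auto simp: packing_design_def intro: finite_bichromatic_pairs)
  have "bichromatic_pairs B f = {p \<in> ?P. ?R p B}" if "B \<in># \<B>" for B
    using assms that by (auto simp: packing_design_def bichromatic_pairs_def)
  then have "(\<Sum>B\<in>#\<B>. card (bichromatic_pairs B f)) = (\<Sum>B\<in>#\<B>. card {p \<in> ?P. ?R p B})"
    by (metis (mono_tags, lifting) image_mset_cong)
  also have "\<dots> = (\<Sum>p\<in>?P. size {#B \<in># \<B>. ?R p B#})"
    by (rule sum_mset_card_eq_sum_size_filter) fact
  also have "\<dots> \<le> (\<Sum>p\<in>?P. 1)"
    by (rule sum_mono) (use assms in \<open>force simp: packing_design_def bichromatic_pairs_def\<close>)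
  finally show ?thesis by simp
qed

theorem theorem2p8:
  fixes v k c m :: nat and q b \<rho> \<beta> :: int
    and V :: "'a set" and \<B> :: "'a set multiset"
    and C :: "'b set" and f :: "'a \<Rightarrow> 'b"
  assumes "v \<ge> k" and "k \<ge> 3" and "c \<ge> 2"
    and "int k = q * int c + b" and "0 \<le> b" and "b < int c"
    and "int v = \<rho> * int c + \<beta>" and "0 \<le> \<beta>" and "\<beta> < int c"
    and "packing_design v k V \<B>"
    and "colouring c V C f"
    and "block_equitable k c V \<B> C f"
    and "size \<B> = m"
  shows "real m \<le>
    (real_of_int \<rho> * (real_of_int \<rho> * real c / 2 + real_of_int \<beta>) * (real c - 1)
       + real_of_int \<beta> / 2 * (real_of_int \<beta> - 1)) /
    (real_of_int q * (real_of_int q * real c / 2 + real_of_int b) * (real c - 1)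
       + real_of_int b / 2 * (real_of_int b - 1))"
proof -
  \<comment> \<open>\<open>?D\<close> is twice the expression in the bound, which keeps the counting
    in the integers.\<close>
  let ?D = "\<lambda>r t. int c * (int c - 1) * r\<^sup>2 + 2 * r * t * (int c - 1) + t * (t - 1)"
  have PD: "finite V" "card V = v" "\<And>B. B \<in># \<B> \<Longrightarrow> B \<subseteq> V \<and> card B = k"
    using assms(10) by (auto simp: packing_design_def)
  have floor: "\<lfloor>real k / real c\<rfloor> = q"
  proof -
    have "real k = real_of_int (q * int c + b)"
      using assms(4) by (metis of_int_of_nat_eq)
    then show ?thesis
      using assms(3,5,6) by (intro floor_unique) (auto simp: field_simps)
  qed
  have block: "int (card (bichromatic_pairs B f)) = ?D q b" if B: "B \<in># \<B>" for B
  proof -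
    have "finite B" and "int (card B) = q * int c + b"
      using PD(1) PD(3)[OF B] assms(4) by (auto intro: finite_subset)
    moreover have "colouring c B C f"
      using assms(11) PD(3)[OF B] by (auto simp: colouring_def)
    moreover have "(\<Sum>\<gamma>\<in>C. (int (card (colour_class B f \<gamma>)) - q) * (int (card (colour_class B f \<gamma>)) - q - 1)) = 0"
    proof (intro sum.neutral ballI)
      fix \<gamma>
      assume \<gamma>: "\<gamma> \<in> C"
      have "colour_class B f \<gamma> = B \<inter> colour_class V f \<gamma>"
        using PD(3)[OF B] by (auto simp: colour_class_def)
      \<comment> \<open>This covers both \<open>b = 0\<close> and \<open>b > 0\<close>: class sizes
        in a block are \<open>q\<close> or \<open>q + 1\<close>, so one factor below
        vanishes.\<close>
      moreover have "\<lceil>real k / real c\<rceil> \<le> q + 1"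
        using floor by linarith
      ultimately have "q \<le> int (card (colour_class B f \<gamma>))"
        "int (card (colour_class B f \<gamma>)) \<le> q + 1"
        using assms(12) B \<gamma> floor by (force simp: block_equitable_def)+
      then show "(int (card (colour_class B f \<gamma>)) - q) * (int (card (colour_class B f \<gamma>)) - q - 1) = 0"
        by auto
    qed
    ultimately show ?thesis
      using card_bichromatic_pairs[of B c C f q b] by simp
  qed
  have "(\<Sum>\<gamma>\<in>C. (int (card (colour_class V f \<gamma>)) - \<rho>) * (int (card (colour_class V f \<gamma>)) - \<rho> - 1)) \<ge> 0"
  proof (rule sum_nonneg)
    \<comment> \<open>Integrality matters: no integer lies strictly between 0 and 1.\<close>
    have "z * (z - 1) \<ge> 0" for z :: int
      by (cases "z \<le> 0") (auto intro: mult_nonpos_nonpos)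
    then show "(int (card (colour_class V f \<gamma>)) - \<rho>) * (int (card (colour_class V f \<gamma>)) - \<rho> - 1) \<ge> 0" for \<gamma>
      by blast
  qed
  then have whole: "int (card (bichromatic_pairs V f)) \<le> ?D \<rho> \<beta>"
    using card_bichromatic_pairs[of V c C f \<rho> \<beta>] PD assms(7,11) by simp
  \<comment> \<open>\<open>nat\<close> truncates nothing, since by \<open>block\<close> its argument
    is a cardinality.\<close>
  have "(\<Sum>B\<in>#\<B>. card (bichromatic_pairs B f)) = (\<Sum>B\<in>#\<B>. nat (?D q b))"
    using block by (metis (mono_tags, lifting) image_mset_cong nat_int)
  then have "size \<B> * nat (?D q b) \<le> card (bichromatic_pairs V f)"
    using sum_bichromatic_pairs_blocks_le[OF assms(10), of f] by simp
  moreover have pos: "?D q b > 0"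
  proof -
    \<comment> \<open>The product is \<open>k + (c - b)\<close>; its positivity excludes negative
      \<open>q\<close>.\<close>
    have "0 < (q + 1) * int c"
      using assms(2,4,6) by (simp add: algebra_simps)
    then have "q \<ge> 0"
      using assms(3) by (simp add: zero_less_mult_iff)
    show ?thesis
    proof (cases "q = 0")
      case True
      \<comment> \<open>Here \<open>b = k \<ge> 3\<close>, so \<open>b * (b - 1)\<close> is
        positive.\<close>
      then show ?thesis using assms(2,4) by auto
    next
      case False
      then have "int c * (int c - 1) * q\<^sup>2 > 0"
        using assms(3) by simp
      moreover have "2 * q * b * (int c - 1) \<ge> 0"
        using assms(3,5) \<open>q \<ge> 0\<close> by simp
      moreover have "b * (b - 1) \<ge> 0"
        using assms(5) by (cases "b = 0") auto
      ultimately show ?thesis by linarith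
    qed
  qed
  ultimately have "int m * ?D q b \<le> ?D \<rho> \<beta>"
    using whole assms(13) by (smt (verit) int_nat_eq of_nat_le_iff of_nat_mult)
  then have "real_of_int (int m * ?D q b) \<le> real_of_int (?D \<rho> \<beta>)"
    by (rule of_int_le_iff[THEN iffD2])
  \<comment> \<open>Halving both sides of the fraction gives the stated form.\<close>
  moreover have half: "real_of_int (?D r t) / 2 =
      real_of_int r * (real_of_int r * real c / 2 + real_of_int t) * (real c - 1)
       + real_of_int t / 2 * (real_of_int t - 1)" for r t
    by (simp add: power2_eq_square field_simps)
  ultimately have "real m \<le> (real_of_int (?D \<rho> \<beta>) / 2) / (real_of_int (?D q b) / 2)"
    using pos by (subst pos_le_divide_eq) (auto simp flip: of_int_0_less_iff[where 'a = real])
  then show ?thesis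
    unfolding half .
qed

end
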